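(* Let $B$ be a Banach space, let $S$ be a nonempty closed convex subset of $B$, and let $T:S\to S$ be a contraction, i.e. there is $\delta\in(0,1)$ with $\|Tx-Ty\|\le\delta\|x-y\|$ for all $x,y\in S$; let $x_*$ be the fixed point of $T$. Let $\{\alpha_n^1\}_{n=0}^\infty,\{\alpha_n^2\}_{n=0}^\infty,\{\alpha_n^3\}_{n=0}^\infty$ be real sequences in $[0,1]$ with $\sum_{k=0}^{\infty}\alpha_k^1=\infty$. Let $u_0,p_0\in S$, and let $\{u_n\}_{n=0}^\infty$ and $\{p_n\}_{n=0}^\infty$ be defined, for $n\in\mathbb{N}$, by $$\begin{aligned} y_n&=(1-\alpha_n^3)u_n+\alpha_n^3Tu_n,\\ v_n&=(1-\alpha_n^2)Tu_n+\alpha_n^2Ty_n,\\ u_{n+1}&=(1-\alpha_n^1)v_n+\alpha_n^1Tv_n, \end{aligned}$$ and $$\begin{aligned} r_n&=(1-\alpha_n^3)p_n+\alpha_n^3Tp_n,\\ q_n&=(1-\alpha_n^2)Tp_n+\alpha_n^2Tr_n,\\ p_{n+1}&=(1-\alpha_n^1)Tp_n+\alpha_n^1Tq_n. \end{aligned}$$ Then the following are equivalent: (i) $\{p_n\}_{n=0}^\infty$ converges to $x_*$; (ii) $\{u_n\}_{n=0}^\infty$ converges to $x_*$.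
   Context: $\mathbb{N}$ denotes the set of nonnegative integers (including zero). In the superscripted symbols $\alpha_n^i$ the superscript $i\in\{1,2,3\}$ is an index, not a power. Convergence is in the norm of $B$. The scheme producing $\{u_n\}$ is called the CR iteration method; the scheme producing $\{p_n\}$ is the three-step iteration of Karahan and Özdemir. *)

theory Defs
  imports "HOL-Analysis.Analysis"
begin

end

theory Submission
  imports Defs
begin

text \<open>
  Write D(R) for the points of S at distance at most R from the fixed point. This set is convex,
  and T maps D(R) into D(\<delta> R). Hence one step of either scheme takes D(R) into D(\<delta> R), so both
  sequences converge geometrically to the fixed point whatever the control sequences are,
  and the equivalence holds because both sides are true.
\<close>

lemma convex_cball_combination:
  fixes S :: "'a::real_normed_vector set"
  assumes "convex S" and "x \<in> S \<inter> cball c R" and "z \<in> S \<inter> cball c R" and "a \<in> {0..1}"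
  shows "(1 - a) *\<^sub>R x + a *\<^sub>R z \<in> S \<inter> cball c R"
  using convexD_alt[OF convex_Int[OF assms(1) convex_cball] assms(2,3)] assms(4) by simp

text \<open>Since \<open>c\<close> equals \<open>T c\<close>, the distance from \<open>c\<close> to
  \<open>T x\<close> is a distance between two images, so the contraction inequality applies to
  it.\<close>

lemma contraction_cball_fixed_point:
  fixes S :: "'a::real_normed_vector set"
  assumes "T \<in> S \<rightarrow> S" and "0 \<le> \<delta>"
    and "\<And>x z. x \<in> S \<Longrightarrow> z \<in> S \<Longrightarrow> norm (T x - T z) \<le> \<delta> * norm (x - z)"
    and "c \<in> S" and "T c = c" and "x \<in> S \<inter> cball c R"
  shows "T x \<in> S \<inter> cball c (\<delta> * R)"
proof -
  have "norm (c - T x) \<le> \<delta> * norm (c - x)"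
    using assms(3)[of c x] assms(4-6) by simp
  also have "\<dots> \<le> \<delta> * R"
    using assms(2,6) by (intro mult_left_mono) (auto simp: dist_norm)
  finally show ?thesis
    using assms(1,6) by (auto simp: dist_norm)
qed

text \<open>Iterating \<open>step\<close> from the initial distance yields a geometric bound on the
  distance to \<open>c\<close>, which squeezes it to 0. The radius in \<open>step\<close> is
  arbitrary because it changes with every iteration.\<close>

lemma tendsto_if_cball_step:
  fixes w :: "nat \<Rightarrow> 'a::real_normed_vector"
  assumes "0 \<le> \<delta>" and "\<delta> < 1" and "w 0 \<in> S"
    and step: "\<And>n R. w n \<in> S \<inter> cball c R \<Longrightarrow> w (Suc n) \<in> S \<inter> cball c (\<delta> * R)"
  shows "w \<longlonglongrightarrow> c"
proof -
  have bound: "w n \<in> S \<inter> cball c (\<delta> ^ n * dist c (w 0))" for n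
  proof (induction n)
    case 0
    then show ?case using assms(3) by simp
  next
    case (Suc n)
    then show ?case using step[OF Suc] by (simp add: mult.assoc)
  qed
  have lim: "(\<lambda>n. \<delta> ^ n * dist c (w 0)) \<longlonglongrightarrow> 0"
    using assms(1,2) by (intro tendsto_mult_left_zero LIMSEQ_power_zero) simp
  have "\<forall>n. norm (dist (w n) c) \<le> \<delta> ^ n * dist c (w 0)"
    using bound by (simp add: dist_commute)
  then have "(\<lambda>n. dist (w n) c) \<longlonglongrightarrow> 0"
    by (rule Lim_null_comparison[OF always_eventually lim])
  then show ?thesis
    by (rule tendsto_dist_iff[THEN iffD2])
qed

theorem theorem2:
  fixes S :: "'a::banach set"
    and T :: "'a \<Rightarrow> 'a"
    and \<delta> :: real
    and x_star :: 'a
    and \<alpha>1 \<alpha>2 \<alpha>3 :: "nat \<Rightarrow> real"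
    and u y v p r q :: "nat \<Rightarrow> 'a"
  assumes "S \<noteq> {}" and "closed S" and "convex S"
    and "T \<in> S \<rightarrow> S"
    and "0 < \<delta>" and "\<delta> < 1"
    and "\<And>x z. x \<in> S \<Longrightarrow> z \<in> S \<Longrightarrow> norm (T x - T z) \<le> \<delta> * norm (x - z)"
    and "x_star \<in> S" and "T x_star = x_star"
    and "\<And>n. \<alpha>1 n \<in> {0..1}"
    and "\<And>n. \<alpha>2 n \<in> {0..1}"
    and "\<And>n. \<alpha>3 n \<in> {0..1}"
    and "filterlim (\<lambda>n. \<Sum>k<n. \<alpha>1 k) at_top sequentially"
    and "u 0 \<in> S"
    and "\<And>n. y n = (1 - \<alpha>3 n) *\<^sub>R u n + \<alpha>3 n *\<^sub>R T (u n)"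
    and "\<And>n. v n = (1 - \<alpha>2 n) *\<^sub>R T (u n) + \<alpha>2 n *\<^sub>R T (y n)"
    and "\<And>n. u (Suc n) = (1 - \<alpha>1 n) *\<^sub>R v n + \<alpha>1 n *\<^sub>R T (v n)"
    and "p 0 \<in> S"
    and "\<And>n. r n = (1 - \<alpha>3 n) *\<^sub>R p n + \<alpha>3 n *\<^sub>R T (p n)"
    and "\<And>n. q n = (1 - \<alpha>2 n) *\<^sub>R T (p n) + \<alpha>2 n *\<^sub>R T (r n)"
    and "\<And>n. p (Suc n) = (1 - \<alpha>1 n) *\<^sub>R T (p n) + \<alpha>1 n *\<^sub>R T (q n)"
  shows "p \<longlonglongrightarrow> x_star \<longleftrightarrow> u \<longlonglongrightarrow> x_star"
proof -
  note comb = convex_cball_combination[OF assms(3)]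
  have T: "T x \<in> S \<inter> cball x_star (\<delta> * R)" if "x \<in> S \<inter> cball x_star R" for x R
    using contraction_cball_fixed_point[OF assms(4) _ assms(7-9) that] assms(5) by simp
  \<comment> \<open>The sign of \<open>R\<close> is not given, and \<delta> * R \<le> R fails for
    negative \<open>R\<close>; a point in the smaller ball forces its radius, hence
    \<open>R\<close>, to be nonnegative.\<close>
  have shrink: "x \<in> S \<inter> cball x_star R" if "x \<in> S \<inter> cball x_star (\<delta> * R)" for x R
  proof -
    have "0 \<le> \<delta> * R"
      using that order_trans[OF zero_le_dist[of x_star x]] by simp
    then have "0 \<le> R"
      using assms(5) by (simp add: zero_le_mult_iff)
    then have "\<delta> * R \<le> R"
      using assms(6) by (simp add: mult_left_le_one_le assms(5) less_imp_le)
    then show ?thesis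
      using that by auto
  qed
  have "u \<longlonglongrightarrow> x_star"
  proof (rule tendsto_if_cball_step)
    fix n R
    assume u: "u n \<in> S \<inter> cball x_star R"
    \<comment> \<open>No factor \<delta> is gained here, as \<open>u n\<close> itself enters the
      combination. The gain comes with \<open>v n\<close>, which combines only images under
      \<open>T\<close>.\<close>
    have y: "y n \<in> S \<inter> cball x_star R"
      unfolding assms(15) by (intro comb u shrink[OF T] assms(12))
    have v: "v n \<in> S \<inter> cball x_star (\<delta> * R)"
      unfolding assms(16) by (intro comb T u y assms(11))
    \<comment> \<open>\<open>T (v n)\<close> lies even within \<delta> * (\<delta> * R);
      \<open>shrink\<close> relaxes this to the radius available for \<open>v n\<close>.\<close>
    show "u (Suc n) \<in> S \<inter> cball x_star (\<delta> * R)"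
      unfolding assms(17) by (intro comb v shrink[OF T] assms(10))
  qed (use assms(5,6,14) in auto)
  moreover have "p \<longlonglongrightarrow> x_star"
  proof (rule tendsto_if_cball_step)
    fix n R
    assume p: "p n \<in> S \<inter> cball x_star R"
    have r: "r n \<in> S \<inter> cball x_star R"
      unfolding assms(19) by (intro comb p shrink[OF T] assms(12))
    \<comment> \<open>Radius \<open>R\<close> suffices: \<open>q n\<close> enters the next iterate
      only through \<open>T\<close>, which supplies the factor \<delta>.\<close>
    have q: "q n \<in> S \<inter> cball x_star R"
      unfolding assms(20) by (intro comb shrink[OF T] p r assms(11))
    show "p (Suc n) \<in> S \<inter> cball x_star (\<delta> * R)"
      unfolding assms(21) by (intro comb T p q assms(10))
  qed (use assms(5,6,18) in auto)
  ultimately show ?thesis by simp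
qed

end
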